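(* Let $(Y,T)$ be the subshift and $\Psi^1$ the flow on the compact metric space $Y^1$ (suspension of $T|_{Y\setminus\{0\}}$ with constant roof function $1$, compactified by one fixed point $y_\infty$) constructed in the context. Then the flow $\Psi^1$ is topologically transitive.
   Context: Construction of $(Y,T)$. $\Sigma(2)=\{0,1\}^{\mathbb Z}$ has the product topology and $T$ is the shift $(x_i)\mapsto(x_{i+1})$. For a finite $0$-$1$ word $A$, $|A|$ is its length; $AB$ denotes concatenation; $O(n)$ is the word of $n$ zeros. Finite words $A_n$, $P(n)$ ($|P(n)|=n$) and $Q_n$, $n\ge1$, are defined recursively. Consider the infinite matrix whose entry in row $r\ge1$ and column $c\ge1$ is $P(r)\,O(r^2-1+c)\,P(r)$; enumerate its entries as $Q_1,Q_2,\dots$ along antidiagonals from top to bottom, i.e. the entry $(r,c)$ is $Q_i$ with $i=\frac{(r+c-2)(r+c-1)}{2}+r$ (so first row: $Q_1,Q_2,Q_4,Q_7,\dots$; second row: $Q_3,Q_5,Q_8,\dots$; third row: $Q_6,Q_9,\dots$). Put $A_1=(1)$, $P(1)=A_1$, and for $n\ge2$ put $A_n=A_{n-1}\,O(|A_{n-1}|^2)\,Q_{n-1}$, and let $P(n)$ be the word formed by the first $n$ symbols of $A_n$ (one has $|A_n|\ge n$; $Q_n$ only involves some $P(j)$ with $j\le n$). Since $A_{n-1}$ is a prefix of $A_n$, the limit $y=\lim_{n\to\infty}(A_n000\cdots)$ exists; it is regarded as an element of $\Sigma(2)$ by setting $y(i)=0$ at negative positions. Let $Y=\omega(y,T)$ be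 the $\omega$-limit set of $y$ under $T$ (it does not depend on the values of $y$ at negative positions), a compact $T$-invariant set on which $T$ is a homeomorphism. Its unique fixed point is the all-zeros sequence, denoted $0$; put $Y_*=Y\setminus\{0\}$. Suspension flow. Let $Y_*^1$ be the quotient of $\{(z,u):z\in Y_*,\ 0\le u\le1\}$ by $(z,1)\sim(Tz,0)$, with the suspension flow determined by $\psi^1_t(z,u)=(z,u+t)$ for $-u\le t<1-u$. Let $Y^1=Y_*^1\cup\{y_\infty\}$ be the one-point compactification, a compact metric space in which $(z_n,u_n)\to y_\infty$ if and only if $z_n\to0$ in $Y$. $\Psi^1$ is the flow on $Y^1$ extending $\psi^1$ by $\Psi^1_t(y_\infty)=y_\infty$ for all $t\in\mathbb R$. A flow $\Psi$ on a compact metric space $Z$ is topologically transitive if there is a point $z\in Z$ with $\omega(z,\Psi)=Z$, where $\omega(z,\Psi)$ is the set of limits of $\Psi_{t_i}(z)$ along sequences $t_i\to+\infty$. *)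

theory Defs
  imports "HOL-Analysis.Analysis" "HOL-Library.Nat_Bijection"
begin

section \<open>The words and the subshift\<close>

text \<open>The alphabet \<open>{0,1}\<close> is \<^typ>\<open>bool\<close> (discrete topology, \<open>True\<close> being the symbol 1), and
  \<^typ>\<open>int \<Rightarrow> bool\<close> carries the product topology.\<close>

abbreviation zeros :: "nat \<Rightarrow> bool list" where
  "zeros n \<equiv> replicate n False"

text \<open>Row and column (counted from 1) of the \<open>i\<close>-th matrix entry, \<open>i \<ge> 1\<close>, in the antidiagonal
  enumeration \<open>i = (r + c - 2) (r + c - 1) / 2 + r\<close>.  The library pairing is
  \<open>prod_encode (m, n) = (m + n) (m + n + 1) / 2 + m\<close>, so that \<open>i - 1 = prod_encode (r - 1, c - 1)\<close>;
  see \<open>q_row_q_col\<close> below.\<close>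

definition q_row :: "nat \<Rightarrow> nat" where
  "q_row i = fst (prod_decode (i - 1)) + 1"

definition q_col :: "nat \<Rightarrow> nat" where
  "q_col i = snd (prod_decode (i - 1)) + 1"

lemma q_row_q_col:
  assumes "1 \<le> r" "1 \<le> c"
  shows "q_row ((r + c - 2) * (r + c - 1) div 2 + r) = r"
    and "q_col ((r + c - 2) * (r + c - 1) div 2 + r) = c"
proof -
  obtain a b where ab: "r = Suc a" "c = Suc b"
    using assms by (metis One_nat_def Suc_le_D)
  have "(r + c - 2) * (r + c - 1) div 2 + r - 1 = prod_encode (a, b)"
    by (simp add: ab prod_encode_def triangle_def)
  then show "q_row ((r + c - 2) * (r + c - 1) div 2 + r) = r"
    and "q_col ((r + c - 2) * (r + c - 1) div 2 + r) = c"
    by (simp_all only: q_row_def q_col_def prod_encode_inverse) (simp_all add: ab)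
qed

lemma q_row_le: "1 \<le> i \<Longrightarrow> q_row i \<le> i"
  using le_prod_encode_1[of "fst (prod_decode (i - 1))" "snd (prod_decode (i - 1))"]
  by (simp add: q_row_def)

text \<open>The index 0 does not occur in the construction; the values there are irrelevant.\<close>

function A_word :: "nat \<Rightarrow> bool list"
  and P_word :: "nat \<Rightarrow> bool list"
  and Q_word :: "nat \<Rightarrow> bool list"
where
  "A_word 0 = []"
| "A_word (Suc 0) = [True]"
| "A_word (Suc (Suc n)) =
     A_word (Suc n) @ zeros ((length (A_word (Suc n)))\<^sup>2) @ Q_word (Suc n)"
| "P_word n = take n (A_word n)"
| "Q_word 0 = []"
| "Q_word (Suc n) =
     P_word (q_row (Suc n)) @ zeros ((q_row (Suc n))\<^sup>2 - 1 + q_col (Suc n)) @ P_word (q_row (Suc n))"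
  by pat_completeness auto
termination
proof (relation "Wellfounded.measure (\<lambda>x. case x of Inl n \<Rightarrow> 3 * n
    | Inr (Inl n) \<Rightarrow> 3 * n + 1 | Inr (Inr n) \<Rightarrow> 3 * n + 2)", goal_cases)
  case (6 n) show ?case using q_row_le[of "Suc n"] by simp
next
  case (7 n) show ?case using q_row_le[of "Suc n"] by simp
qed auto

lemma Q_word_entry:
  assumes "1 \<le> r" "1 \<le> c"
  shows "Q_word ((r + c - 2) * (r + c - 1) div 2 + r) = P_word r @ zeros (r\<^sup>2 - 1 + c) @ P_word r"
proof -
  obtain m where m: "(r + c - 2) * (r + c - 1) div 2 + r = Suc m"
    using assms(1) by (metis One_nat_def Suc_le_D add_Suc_right)
  show ?thesis
    using q_row_q_col[OF assms] unfolding m by simp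
qed

lemma le_length_A_word: "n \<le> length (A_word n)"
proof (induction n)
  case (Suc n)
  show ?case
  proof (cases n)
    case (Suc m)
    have "1 \<le> (length (A_word n))\<^sup>2"
      using le_trans[OF _ Suc.IH, of 1] Suc by (simp only: one_le_power)
    moreover have "length (A_word n) + (length (A_word n))\<^sup>2 \<le> length (A_word (Suc n))"
      by (simp add: Suc del: P_word.simps Q_word.simps)
    ultimately show ?thesis using Suc.IH by linarith
  qed simp
qed simp

text \<open>The two-sided sequence with \<open>w000\<dots>\<close> at the positions \<open>0, 1, 2, \<dots>\<close> and zeros at the
  negative ones.\<close>

definition pad :: "bool list \<Rightarrow> int \<Rightarrow> bool" where
  "pad w i \<longleftrightarrow> 0 \<le> i \<and> nat i < length w \<and> w ! nat i"

definition y_seq :: "int \<Rightarrow> bool" where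
  "y_seq = (THE x. (\<lambda>n. pad (A_word n)) \<longlonglongrightarrow> x)"

lemma tendsto_bool_seq_iff:
  fixes f :: "'b \<Rightarrow> int \<Rightarrow> bool"
  shows "(f \<longlongrightarrow> l) F \<longleftrightarrow> (\<forall>i. eventually (\<lambda>k. f k i = l i) F)"
proof -
  have "(f \<longlongrightarrow> l) F \<longleftrightarrow> limitin (product_topology (\<lambda>_. euclidean) UNIV) f l F"
    by (simp add: euclidean_product_topology)
  also have "\<dots> \<longleftrightarrow> (\<forall>i. eventually (\<lambda>k. f k i = l i) F)"
    by (simp add: limitin_componentwise tendsto_discrete)
  finally show ?thesis .
qed

lemma A_word_nth:
  assumes "i < m" "m \<le> n" shows "A_word n ! i = A_word m ! i"
  using assms(2,1)
proof (induction n rule: dec_induct)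
  case (step n)
  have "i < length (A_word n)"
    using step le_length_A_word[of n] by linarith
  with step show ?case by (cases n) (auto simp: nth_append)
qed simp

lemma A_word_tendsto:
  "(\<lambda>n. pad (A_word n)) \<longlonglongrightarrow> (\<lambda>i. 0 \<le> i \<and> A_word (nat i + 1) ! nat i)"
proof -
  have "\<forall>\<^sub>F n in sequentially. pad (A_word n) i = (0 \<le> i \<and> A_word (nat i + 1) ! nat i)" for i
    using eventually_ge_at_top[of "nat i + 1"]
  proof eventually_elim
    case (elim n)
    then have "nat i < length (A_word n)"
      using le_length_A_word[of n] by linarith
    then show ?case
      using A_word_nth[of "nat i" "nat i + 1" n] elim by (auto simp: pad_def)
  qed
  then show ?thesis by (simp add: tendsto_bool_seq_iff)
qed

lemma y_seq_eq: "y_seq = (\<lambda>i. 0 \<le> i \<and> A_word (nat i + 1) ! nat i)"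
  unfolding y_seq_def
proof (rule the_equality, rule A_word_tendsto)
  fix x assume "(\<lambda>n. pad (A_word n)) \<longlonglongrightarrow> x"
  then have x: "\<forall>\<^sub>F n in sequentially. pad (A_word n) i = x i" for i
    by (simp add: tendsto_bool_seq_iff)
  have y: "\<forall>\<^sub>F n in sequentially. pad (A_word n) i = (0 \<le> i \<and> A_word (nat i + 1) ! nat i)" for i
    using A_word_tendsto unfolding tendsto_bool_seq_iff by (rule spec)
  have "x i = (0 \<le> i \<and> A_word (nat i + 1) ! nat i)" for i
    using eventually_happens[OF eventually_conj[OF x[of i] y[of i]]] by auto
  then show "x = (\<lambda>i. 0 \<le> i \<and> A_word (nat i + 1) ! nat i)"
    by (rule ext)
qed

definition shift :: "(int \<Rightarrow> bool) \<Rightarrow> int \<Rightarrow> bool" where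
  "shift x = (\<lambda>i. x (i + 1))"

definition omega_limit_map :: "('a::topological_space \<Rightarrow> 'a) \<Rightarrow> 'a \<Rightarrow> 'a set" where
  "omega_limit_map T x =
     {w. \<exists>s :: nat \<Rightarrow> nat. filterlim s at_top sequentially \<and> (\<lambda>k. (T ^^ s k) x) \<longlonglongrightarrow> w}"

definition Y :: "(int \<Rightarrow> bool) set" where
  "Y = omega_limit_map shift y_seq"

definition Y_star :: "(int \<Rightarrow> bool) set" where
  "Y_star = Y - {\<lambda>_. False}"

section \<open>The suspension and its compactification\<close>

definition quotient_topology :: "'a topology \<Rightarrow> ('a \<times> 'a) set \<Rightarrow> 'a set topology" where
  "quotient_topology X R =
     topology (\<lambda>U. U \<subseteq> topspace X // R \<and> openin X {x \<in> topspace X. R `` {x} \<in> U})"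

lemma openin_quotient_topology:
  "openin (quotient_topology X R) U \<longleftrightarrow>
     U \<subseteq> topspace X // R \<and> openin X {x \<in> topspace X. R `` {x} \<in> U}"
proof -
  have "istopology (\<lambda>U. U \<subseteq> topspace X // R \<and> openin X {x \<in> topspace X. R `` {x} \<in> U})"
    (is "istopology ?P")
    unfolding istopology_def
  proof (intro conjI allI impI)
    fix S T assume "?P S" "?P T"
    moreover have "{x \<in> topspace X. R `` {x} \<in> S \<inter> T} =
        {x \<in> topspace X. R `` {x} \<in> S} \<inter> {x \<in> topspace X. R `` {x} \<in> T}" by auto
    ultimately show "S \<inter> T \<subseteq> topspace X // R"
      and "openin X {x \<in> topspace X. R `` {x} \<in> S \<inter> T}"
      by (auto simp only: openin_Int)
  next
    fix K assume K: "\<forall>U\<in>K. ?P U"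
    have "{x \<in> topspace X. R `` {x} \<in> \<Union>K} = (\<Union>U\<in>K. {x \<in> topspace X. R `` {x} \<in> U})" by auto
    then show "openin X {x \<in> topspace X. R `` {x} \<in> \<Union>K}"
      using K by (simp only:) (rule openin_Union, auto)
    show "\<Union>K \<subseteq> topspace X // R" using K by auto
  qed
  then show ?thesis
    by (simp add: quotient_topology_def)
qed

lemma topspace_quotient_topology: "topspace (quotient_topology X R) = topspace X // R"
proof (rule subset_antisym)
  show "topspace (quotient_topology X R) \<subseteq> topspace X // R"
    unfolding topspace_def[of "quotient_topology X R"] openin_quotient_topology by blast
  have "{x \<in> topspace X. R `` {x} \<in> topspace X // R} = topspace X"
    by (auto intro: quotientI)
  then have "openin (quotient_topology X R) (topspace X // R)"
    by (simp add: openin_quotient_topology)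
  then show "topspace X // R \<subseteq> topspace (quotient_topology X R)"
    by (rule openin_subset)
qed

lemma quotient_map_quotient_topology:
  "quotient_map X (quotient_topology X R) (\<lambda>x. R `` {x})"
  unfolding quotient_map_def topspace_quotient_topology openin_quotient_topology
  by (auto simp: quotient_def)

definition cylinder :: "((int \<Rightarrow> bool) \<times> real) set" where
  "cylinder = Y_star \<times> {0..1}"

definition glue :: "(int \<Rightarrow> bool) \<times> real \<Rightarrow> (int \<Rightarrow> bool) \<times> real \<Rightarrow> bool" where
  "glue p q \<longleftrightarrow> (\<exists>z\<in>Y_star. p = (z, 1) \<and> q = (shift z, 0))"

definition susp_rel :: "(((int \<Rightarrow> bool) \<times> real) \<times> ((int \<Rightarrow> bool) \<times> real)) set" where
  "susp_rel = {(p, q). p \<in> cylinder \<and> q \<in> cylinder \<and> equivclp glue p q}"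

definition suspension :: "((int \<Rightarrow> bool) \<times> real) set topology" where
  "suspension = quotient_topology (top_of_set cylinder) susp_rel"

text \<open>The iterates \<open>shift\<^sup>k\<close> for integers \<open>k\<close>.\<close>

definition shift_pow :: "int \<Rightarrow> (int \<Rightarrow> bool) \<Rightarrow> int \<Rightarrow> bool" where
  "shift_pow k x = (\<lambda>i. x (i + k))"

lemma shift_pow_of_nat: "shift_pow (int n) = shift ^^ n"
proof (induction n)
  case (Suc n)
  have "shift_pow (int (Suc n)) x = shift (shift_pow (int n) x)" for x
    by (simp add: shift_pow_def shift_def algebra_simps)
  then show ?case using Suc by (auto simp: fun_eq_iff)
qed (auto simp: shift_pow_def)

lemma shift_pow_add: "shift_pow j (shift_pow k x) = shift_pow (j + k) x"
  by (simp add: shift_pow_def algebra_simps)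

lemma shift_pow_simps [simp]: "shift_pow 0 x = x" "shift_pow 1 x = shift x"
  by (simp_all add: shift_pow_def shift_def)

text \<open>Closed form of the suspension flow; \<open>suspension_flow_determined\<close> below shows that it is the
  only \<open>\<real>\<close>-action on the suspension given by \<open>(z, u) \<mapsto> (z, u + t)\<close> for \<open>-u \<le> t < 1 - u\<close>.\<close>

definition suspension_flow :: "real \<Rightarrow> ((int \<Rightarrow> bool) \<times> real) set \<Rightarrow> ((int \<Rightarrow> bool) \<times> real) set" where
  "suspension_flow t C =
     susp_rel `` ((\<lambda>(z, u). (shift_pow \<lfloor>u + t\<rfloor> z, frac (u + t))) ` C)"

lemma shift_pow_mem_Y: "shift_pow k x \<in> Y" if x: "x \<in> Y"
proof -
  obtain s where s: "filterlim s at_top sequentially" "(\<lambda>j. (shift ^^ s j) y_seq) \<longlonglongrightarrow> x"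
    using x unfolding Y_def omega_limit_map_def by blast
  let ?s = "\<lambda>j. nat (int (s j) + k)"
  have ev: "\<forall>\<^sub>F j in sequentially. n \<le> s j" for n
    using s(1) by (simp add: filterlim_at_top)
  have "filterlim ?s at_top sequentially"
    unfolding filterlim_at_top
  proof
    fix n
    show "\<forall>\<^sub>F j in sequentially. n \<le> ?s j"
      using ev[of "n + nat \<bar>k\<bar>"] by eventually_elim auto
  qed
  moreover have "(\<lambda>j. (shift ^^ ?s j) y_seq) \<longlonglongrightarrow> shift_pow k x"
    unfolding tendsto_bool_seq_iff
  proof
    fix i
    have "\<forall>\<^sub>F j in sequentially. (shift ^^ s j) y_seq (i + k) = x (i + k)"
      using s(2) by (simp add: tendsto_bool_seq_iff)
    then show "\<forall>\<^sub>F j in sequentially. (shift ^^ ?s j) y_seq i = shift_pow k x i"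
      using ev[of "nat \<bar>k\<bar>"]
      
    proof eventually_elim
      case (elim j)
      then have "int (nat (int (s j) + k)) = int (s j) + k" by simp
      then show ?case
        using elim(1) by (simp add: shift_pow_def algebra_simps flip: shift_pow_of_nat)
    qed
  qed
  ultimately show ?thesis
    unfolding Y_def omega_limit_map_def by blast
qed

lemma shift_pow_mem_Y_star: "shift_pow k x \<in> Y_star" if "x \<in> Y_star"
proof -
  have "x = (\<lambda>_. False)" if "shift_pow k x = (\<lambda>_. False)"
    using arg_cong[OF that, of "shift_pow (- k)"] by (simp add: shift_pow_add) (simp add: shift_pow_def)
  then show ?thesis
    using that shift_pow_mem_Y[of x k] by (auto simp: Y_star_def)
qed

lemma equiv_susp_rel: "equiv cylinder susp_rel"
proof (rule equivI)
  show "refl_on cylinder susp_rel"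
    by (auto simp: refl_on_def susp_rel_def)
  show "sym susp_rel"
    by (auto simp: sym_def susp_rel_def intro: equivclp_sym)
  show "trans susp_rel"
    by (auto simp: trans_def susp_rel_def intro: equivclp_trans)
qed (auto simp: susp_rel_def)

lemma topspace_suspension: "topspace suspension = cylinder // susp_rel"
  by (simp add: suspension_def topspace_quotient_topology)

lemma suspension_class_top:
  assumes "z \<in> Y_star"
  shows "susp_rel `` {(z, 1)} = susp_rel `` {(shift z, 0)}"
proof (rule equiv_class_eq[OF equiv_susp_rel])
  show "((z, 1), (shift z, 0)) \<in> susp_rel"
    using assms shift_pow_mem_Y_star[of z 1]
    by (auto simp: susp_rel_def cylinder_def glue_def intro!: r_into_equivclp)
qed

lemma suspension_flow_class:
  assumes "z \<in> Y_star" "0 \<le> u" "u \<le> 1"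
  shows "suspension_flow t (susp_rel `` {(z, u)}) =
    susp_rel `` {(shift_pow \<lfloor>u + t\<rfloor> z, frac (u + t))}"
proof -
  define f where "f = (\<lambda>(z, u). (shift_pow \<lfloor>u + t\<rfloor> z, frac (u + t)))"
  have glue: "f p = f q" if "glue p q" for p q
  proof -
    obtain x where x: "p = (x, 1)" "q = (shift x, 0)" using \<open>glue p q\<close> by (auto simp: glue_def)
    have "frac (1 + t) = frac t" "\<lfloor>1 + t\<rfloor> = \<lfloor>t\<rfloor> + 1" by (simp_all add: frac_def)
    then show ?thesis
      by (simp add: f_def x shift_pow_add[of _ 1, simplified] add.commute[of 1])
  qed
  have "f p = f q" if "equivclp glue p q" for p q
    using that
  proof (induction rule: equivclp_induct)
    case (step q r)
    then show ?case using glue by metis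
  qed simp
  then have "f ` (susp_rel `` {(z, u)}) = {f (z, u)}"
    using equiv_class_self[OF equiv_susp_rel, of "(z, u)"] assms
    by (force simp: susp_rel_def cylinder_def)
  then show ?thesis by (simp add: suspension_flow_def f_def)
qed

lemma suspension_flow_local:
  assumes "z \<in> Y_star" "0 \<le> u" "u \<le> 1" "- u \<le> t" "t < 1 - u"
  shows "suspension_flow t (susp_rel `` {(z, u)}) = susp_rel `` {(z, u + t)}"
proof -
  have "\<lfloor>u + t\<rfloor> = 0" "frac (u + t) = u + t"
    using assms by (simp_all add: floor_eq_iff frac_eq)
  then show ?thesis using assms by (simp add: suspension_flow_class)
qed

lemma suspension_cases:
  assumes "C \<in> topspace suspension"
  obtains z u where "z \<in> Y_star" "0 \<le> u" "u < 1" "C = susp_rel `` {(z, u)}"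
proof -
  obtain z u where zu: "z \<in> Y_star" "0 \<le> u" "u \<le> 1" "C = susp_rel `` {(z, u)}"
    using assms by (auto simp: topspace_suspension cylinder_def elim!: quotientE)
  show thesis
  proof (cases "u = 1")
    case True
    then show thesis
      using zu suspension_class_top[of z] shift_pow_mem_Y_star[of z 1] that[of "shift z" 0] by simp
  qed (use zu that[of z u] in simp)
qed

lemma suspension_flow_group:
  assumes "C \<in> topspace suspension"
  shows "suspension_flow t C \<in> topspace suspension"
    and "suspension_flow 0 C = C"
    and "suspension_flow (s + t) C = suspension_flow s (suspension_flow t C)"
proof -
  obtain z u where zu: "z \<in> Y_star" "0 \<le> u" "u < 1" "C = susp_rel `` {(z, u)}"
    using assms by (rule suspension_cases)
  have mem: "shift_pow \<lfloor>u + t\<rfloor> z \<in> Y_star" and fr: "0 \<le> frac (u + t)" "frac (u + t) \<le> 1"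
    using zu shift_pow_mem_Y_star frac_lt_1[of "u + t"] by (auto simp: less_imp_le)
  show "suspension_flow t C \<in> topspace suspension"
    using zu mem fr
    by (auto simp: suspension_flow_class topspace_suspension cylinder_def intro!: quotientI)
  show "suspension_flow 0 C = C"
    using zu suspension_flow_local[of z u 0] by simp
  have eq: "frac (u + t) + s = (u + (s + t)) - of_int \<lfloor>u + t\<rfloor>"
    by (simp add: frac_def)
  have "\<lfloor>frac (u + t) + s\<rfloor> + \<lfloor>u + t\<rfloor> = \<lfloor>u + (s + t)\<rfloor>"
    unfolding eq by simp
  moreover have "frac (frac (u + t) + s) = frac (u + (s + t))"
    unfolding eq by (simp add: frac_def)
  ultimately show "suspension_flow (s + t) C = suspension_flow s (suspension_flow t C)"
    using zu mem fr by (simp add: suspension_flow_class shift_pow_add)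
qed

lemma suspension_flow_determined:
  fixes \<phi> :: "real \<Rightarrow> ((int \<Rightarrow> bool) \<times> real) set \<Rightarrow> ((int \<Rightarrow> bool) \<times> real) set"
  assumes zero: "\<And>C. C \<in> topspace suspension \<Longrightarrow> \<phi> 0 C = C"
    and add: "\<And>s t C. C \<in> topspace suspension \<Longrightarrow> \<phi> (s + t) C = \<phi> s (\<phi> t C)"
    and loc: "\<And>z u t. \<lbrakk>z \<in> Y_star; 0 \<le> u; u \<le> 1; - u \<le> t; t < 1 - u\<rbrakk>
      \<Longrightarrow> \<phi> t (susp_rel `` {(z, u)}) = susp_rel `` {(z, u + t)}"
    and C: "C \<in> topspace suspension"
  shows "\<phi> t C = suspension_flow t C"
proof -
  have cls: "susp_rel `` {(z, u)} \<in> topspace suspension" if "z \<in> Y_star" "0 \<le> u" "u \<le> 1" for z u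
    using that by (auto simp: topspace_suspension cylinder_def intro!: quotientI)
  have one: "\<phi> 1 (susp_rel `` {(z, 0)}) = susp_rel `` {(shift z, 0)}" if z: "z \<in> Y_star" for z
  proof -
    have "\<phi> (1 + (- 1)) (susp_rel `` {(z, 1)}) = \<phi> 1 (susp_rel `` {(z, 0)})"
      using z cls[of z 1] loc[of z 1 "-1"] add[of "susp_rel `` {(z, 1)}" 1 "-1"] by simp
    then show ?thesis
      using z zero cls[of z 1] by (simp add: suspension_class_top)
  qed
  have pos: "\<phi> (real n) (susp_rel `` {(z, 0)}) = susp_rel `` {(shift_pow (int n) z, 0)}"
    if z: "z \<in> Y_star" for z n
  proof (induction n)
    case 0
    then show ?case using z cls zero by simp
  next
    case (Suc n)
    have "\<phi> (real (Suc n)) (susp_rel `` {(z, 0)}) = \<phi> 1 (\<phi> (real n) (susp_rel `` {(z, 0)}))"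
      using add[of "susp_rel `` {(z, 0)}" 1 "real n"] z cls by (simp add: add.commute)
    also have "\<dots> = susp_rel `` {(shift (shift_pow (int n) z), 0)}"
      using Suc z shift_pow_mem_Y_star one by simp
    also have "shift (shift_pow (int n) z) = shift_pow (int (Suc n)) z"
      by (simp add: shift_pow_add flip: shift_pow_simps(2))
    finally show ?case .
  qed
  have int: "\<phi> (of_int k) (susp_rel `` {(z, 0)}) = susp_rel `` {(shift_pow k z, 0)}"
    if z: "z \<in> Y_star" for z k
  proof (cases "0 \<le> k")
    case True
    then show ?thesis using pos[OF z, of "nat k"] by simp
  next
    case False
    define w where "w = shift_pow k z"
    have w: "w \<in> Y_star" "shift_pow (- k) w = z"
      using z shift_pow_mem_Y_star by (simp_all add: w_def shift_pow_add)
    have "\<phi> (of_int (- k)) (susp_rel `` {(w, 0)}) = susp_rel `` {(z, 0)}"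
      using pos[OF w(1), of "nat (- k)"] False w by simp
    then have "\<phi> (of_int k) (susp_rel `` {(z, 0)}) = \<phi> (of_int k + of_int (- k)) (susp_rel `` {(w, 0)})"
      using add[of "susp_rel `` {(w, 0)}" "of_int k" "of_int (- k)"] cls[of w 0] w by simp
    then show ?thesis using zero cls[of w 0] w by (simp add: w_def)
  qed
  obtain z u where zu: "z \<in> Y_star" "0 \<le> u" "u < 1" "C = susp_rel `` {(z, u)}"
    using C by (rule suspension_cases)
  have z0: "susp_rel `` {(z, 0)} \<in> topspace suspension"
    using zu cls by simp
  have "\<phi> t C = \<phi> (t + u) (susp_rel `` {(z, 0)})"
    using zu loc[of z 0 u] add[OF z0] by simp
  also have "t + u = frac (u + t) + of_int \<lfloor>u + t\<rfloor>"
    by (simp add: frac_def)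
  also have "\<phi> \<dots> (susp_rel `` {(z, 0)}) =
      susp_rel `` {(shift_pow \<lfloor>u + t\<rfloor> z, frac (u + t))}"
    using add[OF z0] int[OF zu(1)] loc[of "shift_pow \<lfloor>u + t\<rfloor> z" 0 "frac (u + t)"]
      shift_pow_mem_Y_star[OF zu(1)] frac_lt_1[of "u + t"] by simp
  also have "\<dots> = suspension_flow t C"
    using zu by (simp add: suspension_flow_class)
  finally show ?thesis .
qed

text \<open>\<^const>\<open>None\<close> is the point \<open>y\<^sub>\<infinity>\<close> added by the compactification.\<close>

definition Y1 :: "((int \<Rightarrow> bool) \<times> real) set option topology" where
  "Y1 = Alexandroff_compactification suspension"

definition Psi1 :: "real \<Rightarrow> ((int \<Rightarrow> bool) \<times> real) set option \<Rightarrow> ((int \<Rightarrow> bool) \<times> real) set option" where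
  "Psi1 t = map_option (suspension_flow t)"

section \<open>Topological transitivity\<close>

definition omega_limit_flow :: "'a topology \<Rightarrow> (real \<Rightarrow> 'a \<Rightarrow> 'a) \<Rightarrow> 'a \<Rightarrow> 'a set" where
  "omega_limit_flow X \<Phi> z =
     {w. \<exists>t :: nat \<Rightarrow> real. filterlim t at_top sequentially \<and>
           limitin X (\<lambda>k. \<Phi> (t k) z) w sequentially}"

definition topologically_transitive :: "'a topology \<Rightarrow> (real \<Rightarrow> 'a \<Rightarrow> 'a) \<Rightarrow> bool" where
  "topologically_transitive X \<Phi> \<longleftrightarrow> (\<exists>z\<in>topspace X. omega_limit_flow X \<Phi> z = topspace X)"

end

theory Submission
  imports Defs
begin

text \<open>
  The point \<open>y\<close> is recurrent: each row of the matrix contributes a word \<open>Q\<^sub>n\<close> starting with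
  \<open>P(r)\<close>, and in \<open>y\<close> this word is preceded by \<open>|A\<^sub>n|\<^sup>2\<close> zeros, so that \<open>y\<close> returns close to itself
  as \<open>r \<rightarrow> \<infinity>\<close>.  Hence \<open>y \<in> Y \<setminus> {0}\<close>, and the flow orbit of \<open>(y, 0)\<close> accumulates at
  every \<open>(w, u)\<close> because the shift orbit of \<open>y\<close> accumulates at \<open>w\<close>.  It accumulates at the added
  point because the long blocks of zeros make the shift orbit accumulate at \<open>0\<close>, while a compact
  subset of the suspension keeps a bounded distance to the nearest symbol 1.
\<close>

section \<open>Reading off the symbols of \<open>y_seq\<close>\<close>

lemma A_word_Suc:
  assumes "1 \<le> n"
  shows "A_word (Suc n) = A_word n @ zeros ((length (A_word n))\<^sup>2) @ Q_word n"
  using assms by (cases n) (simp_all del: P_word.simps Q_word.simps)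

text \<open>Unlike \<open>A_word_nth\<close>, this covers all positions of \<open>A_word m\<close>,
  which may be far longer than \<open>m\<close>; the gaps and copies below lie beyond position
  \<open>m\<close>.\<close>

lemma A_word_prefix:
  assumes "i < length (A_word m)" "m \<le> n"
  shows "i < length (A_word n)" "A_word n ! i = A_word m ! i"
proof -
  have "i < length (A_word n) \<and> A_word n ! i = A_word m ! i"
    using assms(2)
  proof (induction n rule: dec_induct)
    case (step n)
    then have "1 \<le> n" using assms(1) by (cases m) auto
    then show ?case using step by (auto simp: A_word_Suc nth_append)
  qed (use assms in auto)
  then show "i < length (A_word n)" "A_word n ! i = A_word m ! i" by auto
qed

lemma y_seq_nth:
  assumes "i < length (A_word n)"
  shows "y_seq (int i) = A_word n ! i"
proof -
  have "A_word (max n (i + 1)) ! i = A_word (i + 1) ! i"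
    by (rule A_word_nth) auto
  moreover have "A_word (max n (i + 1)) ! i = A_word n ! i"
    by (rule A_word_prefix) (use assms in auto)
  ultimately show ?thesis by (simp add: y_seq_eq)
qed

text \<open>These positions form the block of zeros separating \<open>A_word n\<close> from
  \<open>Q_word n\<close> in \<open>A_word (Suc n)\<close>.\<close>

lemma y_seq_gap:
  assumes "1 \<le> n" "length (A_word n) \<le> i" "i < length (A_word n) + (length (A_word n))\<^sup>2"
  shows "\<not> y_seq (int i)"
proof -
  have "i - length (A_word n) < (length (A_word n))\<^sup>2" using assms(2,3) by linarith
  then show ?thesis
    using assms y_seq_nth[of i "Suc n"] by (simp add: A_word_Suc nth_append)
qed

text \<open>Right after that block \<open>Q_word n\<close> opens with
  \<open>P_word (q_row n)\<close>, a prefix of \<open>A_word (q_row n)\<close> and hence of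
  \<open>y_seq\<close>.\<close>

lemma y_seq_copy:
  assumes "1 \<le> n" "j < q_row n"
  shows "y_seq (int (length (A_word n) + (length (A_word n))\<^sup>2 + j)) = y_seq (int j)"
proof -
  let ?i = "length (A_word n) + (length (A_word n))\<^sup>2 + j"
  let ?r = "q_row n"
  obtain m where Q: "n = Suc m" using assms(1) by (cases n) auto
  have len: "length (P_word ?r) = ?r" and nth: "P_word ?r ! j = A_word ?r ! j"
    using le_length_A_word[of ?r] assms(2) by auto
  have "j < length (Q_word n)" "Q_word n ! j = P_word ?r ! j"
    using len assms(2) by (simp_all add: Q nth_append del: P_word.simps)
  then have "?i < length (A_word (Suc n))" "A_word (Suc n) ! ?i = P_word ?r ! j"
    using assms(1) by (simp_all add: A_word_Suc nth_append del: P_word.simps)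
  then show ?thesis
    using y_seq_nth[of ?i "Suc n"] y_seq_nth[of j ?r] nth assms(2) le_length_A_word[of ?r] by simp
qed

lemma y_seq_neg: "i < 0 \<Longrightarrow> \<not> y_seq i"
  by (simp add: y_seq_eq)

lemma y_seq_zero: "y_seq 0"
  by (simp add: y_seq_eq)

section \<open>Accumulation of the shift orbit at \<open>y_seq\<close> and at zero\<close>

lemma y_seq_recurrent: "y_seq \<in> Y"
proof -
  \<comment> \<open>The index of the entry in row \<open>k + 1\<close> and column 1, so the copied
    prefix has length \<open>k + 1\<close>.\<close>
  define n where "n k = Suc (prod_encode (k, 0))" for k
  define L where "L k = length (A_word (n k))" for k
  define s where "s k = L k + (L k)\<^sup>2" for k
  have n: "1 \<le> n k" "q_row (n k) = Suc k" for k
    by (simp_all add: n_def q_row_def)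
  have L: "k < L k" for k
    using le_prod_encode_1[of k 0] le_length_A_word[of "n k"] by (simp add: L_def n_def)
  have Lsq: "k < (L k)\<^sup>2" for k
    using L[of k] self_le_power[of "L k" 2] by simp
  have "k \<le> s k" for k
    using L[of k] by (simp add: s_def)
  then have "filterlim s at_top sequentially"
    by (intro filterlim_at_top_mono[OF filterlim_ident]) simp
  moreover have "(\<lambda>k. (shift ^^ s k) y_seq) \<longlonglongrightarrow> y_seq"
    unfolding tendsto_bool_seq_iff
  proof
    fix i
    show "\<forall>\<^sub>F k in sequentially. (shift ^^ s k) y_seq i = y_seq i"
      using eventually_ge_at_top[of "nat \<bar>i\<bar>"]
    proof eventually_elim
      case (elim k)
      show ?case
      proof (cases "0 \<le> i")
        case True
        then show ?thesis
          using elim y_seq_copy[OF n(1), of "nat i" k] n(2)[of k]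
          by (simp add: shift_pow_def s_def L_def add_ac flip: shift_pow_of_nat)
      next
        case False
        \<comment> \<open>Left of the copy stand \<open>(L k)\<^sup>2\<close>, more than
          \<open>k\<close>, zeros; they match the zeros of \<open>y_seq\<close> at negative
          positions.\<close>
        define j where "j = nat (i + int (s k))"
        have j: "int j = i + int (s k)" and "L k \<le> j" "j < L k + (L k)\<^sup>2"
          using False elim Lsq[of k] unfolding j_def s_def by linarith+
        then have "\<not> y_seq (int j)"
          using y_seq_gap[OF n(1)[of k], of j] by (simp add: L_def)
        then show ?thesis unfolding j
          using False by (simp add: y_seq_neg shift_pow_def flip: shift_pow_of_nat)
      qed
    qed
  qed
  ultimately show ?thesis
    unfolding Y_def omega_limit_map_def by blast
qed

lemma y_seq_mem_Y_star: "y_seq \<in> Y_star"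
  using y_seq_recurrent y_seq_zero by (auto simp: Y_star_def fun_eq_iff)

lemma y_seq_proximal_zero:
  obtains s where "filterlim s at_top sequentially" "(\<lambda>k. (shift ^^ s k) y_seq) \<longlonglongrightarrow> (\<lambda>_. False)"
proof
  \<comment> \<open>A position inside the zero block after \<open>A_word k\<close>, with
    \<open>k\<close> zeros of the block before it and at least \<open>k\<^sup>2 - k\<close> from it
    onwards.\<close>
  define s where "s k = length (A_word k) + k" for k
  show "filterlim s at_top sequentially"
    by (rule filterlim_at_top_mono[OF filterlim_ident]) (simp add: s_def)
  show "(\<lambda>k. (shift ^^ s k) y_seq) \<longlonglongrightarrow> (\<lambda>_. False)"
    unfolding tendsto_bool_seq_iff
  proof
    fix i
    show "\<forall>\<^sub>F k in sequentially. (shift ^^ s k) y_seq i = False"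
      \<comment> \<open>The summand 2 ensures \<open>2 * k \<le> k * k\<close>.\<close>
      using eventually_ge_at_top[of "nat \<bar>i\<bar> + 2"]
    proof eventually_elim
      case (elim k)
      have "k + nat \<bar>i\<bar> < 2 * k" using elim by linarith
      also have "2 * k \<le> k * k" using elim by (intro mult_right_mono) auto
      also have "\<dots> \<le> (length (A_word k))\<^sup>2"
        using mult_le_mono[OF le_length_A_word[of k] le_length_A_word[of k]] by (simp add: power2_eq_square)
      finally have bound: "k + nat \<bar>i\<bar> < (length (A_word k))\<^sup>2" .
      define j where "j = nat (i + int (s k))"
      have j: "int j = i + int (s k)" and "length (A_word k) \<le> j"
          "j < length (A_word k) + (length (A_word k))\<^sup>2"
        using elim bound unfolding j_def s_def by linarith+
      then have "\<not> y_seq (int j)"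
        using elim by (intro y_seq_gap) auto
      then show ?case
        unfolding j by (simp add: shift_pow_def flip: shift_pow_of_nat)
    qed
  qed
qed

section \<open>Compact subsets of the suspension\<close>

text \<open>At \<open>u = 1\<close> the class of \<open>(x, u)\<close> has the representative \<open>(shift x, 0)\<close>; interpolating between
  \<open>x\<close> and \<open>shift x\<close> makes these sets both open and saturated.\<close>

definition near_one :: "nat \<Rightarrow> (int \<Rightarrow> bool) \<times> real \<Rightarrow> bool" where
  "near_one n = (\<lambda>(x, u). \<exists>i\<in>{- int n..int n}. u < 1 \<and> x i \<or> 0 < u \<and> shift x i)"

lemma near_one_saturated:
  assumes "(p, q) \<in> susp_rel"
  shows "near_one n p = near_one n q"
proof -
  have "equivclp glue p q" using assms by (simp add: susp_rel_def)
  then show ?thesis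
  proof (induction rule: equivclp_induct)
    case (step q r)
    \<comment> \<open>At \<open>(z, 1)\<close> only the second disjunct survives, at
      \<open>(shift z, 0)\<close> only the first, and both say \<open>shift z i\<close>.\<close>
    then show ?case by (auto simp: glue_def near_one_def)
  qed simp
qed

lemma open_near_one: "open {p. near_one n p}"
proof -
  have coord: "open {p :: (int \<Rightarrow> bool) \<times> real. fst p i}" for i
  proof -
    have "open ((\<lambda>x :: int \<Rightarrow> bool. x i) -` {True})"
      by (rule open_vimage[OF open_discrete continuous_on_product_coordinates])
    then have "open (fst -` ((\<lambda>x :: int \<Rightarrow> bool. x i) -` {True}) :: ((int \<Rightarrow> bool) \<times> real) set)"
      by (rule open_vimage_fst)
    then show ?thesis by (simp add: vimage_def)
  qed
  have "{p. near_one n p} = (\<Union>i\<in>{- int n..int n}.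
      {p. snd p < 1} \<inter> {p. fst p i} \<union> {p. 0 < snd p} \<inter> {p. fst p (i + 1)})"
    by (auto simp: near_one_def shift_def)
  also have "open \<dots>"
    by (intro open_UN ballI open_Un open_Int coord open_Collect_less continuous_intros)
  finally show ?thesis .
qed

lemma near_one_exhausts:
  assumes "p \<in> cylinder"
  shows "\<exists>n. near_one n p"
proof -
  obtain x u where p: "p = (x, u)" "x \<in> Y_star"
    using assms by (auto simp: cylinder_def)
  then obtain i where i: "x i" by (auto simp: Y_star_def fun_eq_iff)
  \<comment> \<open>The extra 1 makes room for the index \<open>i - 1\<close>, at which
    \<open>shift x\<close> shows the symbol when \<open>u = 1\<close>.\<close>
  have "near_one (nat \<bar>i\<bar> + 1) p"
  proof (cases "u < 1")
    case True
    then show ?thesis using i by (auto simp: p near_one_def intro!: bexI[of _ i])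
  next
    case False
    then show ?thesis using i by (auto simp: p near_one_def shift_def intro!: bexI[of _ "i - 1"])
  qed
  then show ?thesis ..
qed

lemma near_one_mono: "m \<le> n \<Longrightarrow> near_one m p \<Longrightarrow> near_one n p"
  unfolding near_one_def by (cases p) (auto intro: order.trans)

text \<open>The sets \<open>near_one n\<close> induce an increasing open cover of the suspension, so
  a finite subcover of \<open>K\<close> yields one window that works for all of
  \<open>K\<close>.\<close>

lemma compactin_suspension_near_one:
  assumes "compactin suspension K"
  obtains n where "\<And>p. p \<in> cylinder \<Longrightarrow> susp_rel `` {p} \<in> K \<Longrightarrow> near_one n p"
proof -
  define U where "U n = (\<lambda>p. susp_rel `` {p}) ` {p \<in> cylinder. near_one n p}" for n
  \<comment> \<open>Saturation lets membership be tested on any representative, so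
    \<open>U n\<close> has an open preimage.\<close>
  have mem_U: "susp_rel `` {p} \<in> U n \<longleftrightarrow> near_one n p" if "p \<in> cylinder" for p n
    using that near_one_saturated[of p] eq_equiv_class_iff[OF equiv_susp_rel that]
    unfolding U_def by (blast intro: imageI)
  have "openin suspension (U n)" for n
  proof -
    have "{p \<in> cylinder. susp_rel `` {p} \<in> U n} = cylinder \<inter> {p. near_one n p}"
      using mem_U by auto
    then show ?thesis
      using open_near_one[of n]
      by (auto simp: suspension_def openin_quotient_topology U_def intro: quotientI)
  qed
  moreover have "K \<subseteq> \<Union> (range U)"
  proof
    fix C assume "C \<in> K"
    then have "C \<in> cylinder // susp_rel"
      using compactin_subset_topspace[OF assms] by (auto simp: topspace_suspension)
    then obtain p where "p \<in> cylinder" "C = susp_rel `` {p}" by (rule quotientE)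
    then show "C \<in> \<Union> (range U)" using near_one_exhausts[of p] mem_U by auto
  qed
  ultimately obtain F where F: "finite F" "F \<subseteq> range U" "K \<subseteq> \<Union> F"
    using assms unfolding compactin_def by (metis (no_types, lifting) rangeE)
  obtain N where N: "finite N" "F = U ` N" using finite_subset_image[OF F(1,2)] by auto
  show thesis
  proof
    fix p assume p: "p \<in> cylinder" "susp_rel `` {p} \<in> K"
    then obtain n where "n \<in> N" "susp_rel `` {p} \<in> U n" using F(3) N(2) by blast
    then have "n \<in> N" "near_one n p" using mem_U[OF p(1)] by auto
    then show "near_one (Max N) p" using N(1) near_one_mono Max_ge by blast
  qed
qed

section \<open>Limits in the suspension and in \<open>Y1\<close>\<close>

lemma limitin_suspension_class:
  assumes "range x \<subseteq> Y_star" "x \<longlonglongrightarrow> w" "w \<in> Y_star" "0 \<le> u" "u \<le> 1"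
  shows "limitin suspension (\<lambda>k. susp_rel `` {(x k, u)}) (susp_rel `` {(w, u)}) sequentially"
proof -
  have cont: "continuous_map (top_of_set cylinder) suspension (\<lambda>p. susp_rel `` {p})"
    unfolding suspension_def by (rule quotient_imp_continuous_map[OF quotient_map_quotient_topology])
  have lim: "limitin (top_of_set cylinder) (\<lambda>k. (x k, u)) (w, u) sequentially"
    using assms by (auto simp: limitin_subtopology cylinder_def intro!: tendsto_intros always_eventually)
  show ?thesis
    using continuous_map_limit[OF cont lim] by (simp add: comp_def)
qed

text \<open>A neighbourhood of \<open>None\<close> omits only a compact \<open>K\<close>, whose
  points show a 1 in a fixed window; \<open>x k\<close> eventually vanishes on that window.\<close>

lemma limitin_Y1_infinity:
  assumes "range x \<subseteq> Y_star" "x \<longlonglongrightarrow> (\<lambda>_. False)"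
  shows "limitin Y1 (\<lambda>k. Some (susp_rel `` {(x k, 0)})) None sequentially"
  unfolding limitin_def
proof (intro conjI allI impI, goal_cases)
  case 1
  then show ?case by (simp add: Y1_def)
next
  case (2 V)
  then obtain K where K: "compactin suspension K" "V = insert None (Some ` (topspace suspension - K))"
    by (auto simp: Y1_def openin_Alexandroff_compactification)
  obtain n where n: "\<And>p. p \<in> cylinder \<Longrightarrow> susp_rel `` {p} \<in> K \<Longrightarrow> near_one n p"
    using compactin_suspension_near_one[OF K(1)] by blast
  have "\<forall>\<^sub>F k in sequentially. \<forall>i\<in>{- int n..int n}. x k i = False"
    using assms(2) by (intro eventually_ball_finite) (auto simp: tendsto_bool_seq_iff)
  then show ?case
  proof eventually_elim
    case (elim k)
    have "(x k, 0) \<in> cylinder" using assms(1) by (auto simp: cylinder_def)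
    moreover have "\<not> near_one n (x k, 0)" using elim by (auto simp: near_one_def)
    ultimately show ?case
      using n K(2) by (auto simp: topspace_suspension intro: quotientI)
  qed
qed

text \<open>Turns return times of the shift into flow times: the integer part counts shifts, the
  fractional part is the height reached.\<close>

lemma Psi1_orbit:
  assumes "z \<in> Y_star" "0 \<le> u" "u < 1"
  shows "Psi1 (real k + u) (Some (susp_rel `` {(z, 0)})) = Some (susp_rel `` {((shift ^^ k) z, u)})"
proof -
  have "\<lfloor>real k + u\<rfloor> = int k" "frac (real k + u) = u"
    using assms by (simp_all add: floor_eq_iff frac_def)
  then show ?thesis
    using assms suspension_flow_class[of z 0 "real k + u"] by (simp add: Psi1_def flip: shift_pow_of_nat)
qed

theorem theoremC:
  shows "topologically_transitive Y1 Psi1"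
proof -
  \<comment> \<open>Recurrence puts \<open>y_seq\<close> in \<open>Y_star\<close>, so this is a
    point of \<open>Y1\<close>.\<close>
  let ?z = "Some (susp_rel `` {(y_seq, 0)})"
  have orbit: "range (\<lambda>k. (shift ^^ s k) y_seq) \<subseteq> Y_star" for s :: "nat \<Rightarrow> nat"
    using shift_pow_mem_Y_star[OF y_seq_mem_Y_star] by (auto simp flip: shift_pow_of_nat)
  have times: "filterlim (\<lambda>k. real (s k) + u) at_top sequentially"
    if "filterlim s at_top sequentially" "0 \<le> u" for s u
    using filterlim_compose[OF filterlim_real_sequentially that(1)]
    by (rule filterlim_at_top_mono) (use that(2) in simp)
  have "w \<in> omega_limit_flow Y1 Psi1 ?z" if w: "w \<in> topspace Y1" for w
  proof (cases w)
    case None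
    obtain s where s: "filterlim s at_top sequentially" "(\<lambda>k. (shift ^^ s k) y_seq) \<longlonglongrightarrow> (\<lambda>_. False)"
      by (rule y_seq_proximal_zero)
    have "limitin Y1 (\<lambda>k. Psi1 (real (s k) + 0) ?z) None sequentially"
      unfolding Psi1_orbit[OF y_seq_mem_Y_star order.refl zero_less_one]
      by (rule limitin_Y1_infinity[OF orbit s(2)])
    then show ?thesis
      using times[OF s(1) order.refl] None unfolding omega_limit_flow_def by blast
  next
    case (Some C)
    then have "C \<in> topspace suspension" using w by (auto simp: Y1_def)
    \<comment> \<open>\<open>suspension_cases\<close> provides a representative with
      \<open>u < 1\<close>, as \<open>Psi1_orbit\<close> requires.\<close>
    then obtain x u where x: "x \<in> Y_star" "0 \<le> u" "u < 1" "C = susp_rel `` {(x, u)}"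
      by (rule suspension_cases)
    then obtain s where s: "filterlim s at_top sequentially" "(\<lambda>k. (shift ^^ s k) y_seq) \<longlonglongrightarrow> x"
      by (auto simp: Y_star_def Y_def omega_limit_map_def)
    have lim: "limitin suspension (\<lambda>k. susp_rel `` {((shift ^^ s k) y_seq, u)}) C sequentially"
      using limitin_suspension_class[OF orbit s(2)] x by simp
    have "limitin Y1 (\<lambda>k. Psi1 (real (s k) + u) ?z) w sequentially"
      unfolding Psi1_orbit[OF y_seq_mem_Y_star x(2,3)] Some Y1_def
      using continuous_map_limit[OF continuous_map_Some lim] by (simp add: comp_def)
    then show ?thesis
      using times[OF s(1) x(2)] unfolding omega_limit_flow_def by blast
  qed
  moreover have "omega_limit_flow Y1 Psi1 ?z \<subseteq> topspace Y1"
    unfolding omega_limit_flow_def by (blast dest: limitin_topspace)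
  moreover have "?z \<in> topspace Y1"
    using y_seq_mem_Y_star by (auto simp: Y1_def topspace_suspension cylinder_def intro!: quotientI)
  ultimately show ?thesis
    unfolding topologically_transitive_def by (meson subsetI subset_antisym)
qed

end
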